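(* Let $T>0$, $m\in\mathbb R$, $r\in(0,\infty)$, and let $W$ be the canonical Brownian motion on $\Omega=C([0,T],\mathbb R)$ with $W_0=x_0$, $|x_0-m|<r$. Let $B(m,r)=\{\omega\in\Omega:\sup_{t\in[0,T]}|\omega(t)-m|\le r\}$. Then, almost surely on $B(m,r)$, it holds for all $p\in(1,2)$ that $$\sup_{t\in[0,T)}\frac{\mathbb P_t[B(m,r)^c]}{(T-t)^{p-1}}<\infty,$$ and, almost surely on $B(m,r)^c$, it holds for all $p>1$ that $$\sup_{t\in[0,T)}\frac{\mathbb P_t[B(m,r)]}{(T-t)^{p-1}}<\infty.$$
   Context: $W_t(\omega)=\omega(t)$ under Wiener measure $\mathbb P$ started at $x_0$, and $(\mathscr F_t)$ is the (completed) filtration generated by $W$. $\mathbb P_t[A]=\mathbb E[\mathbf 1_A\mid\mathscr F_t]$, taken as a continuous version of the martingale. *)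

theory Defs
  imports "HOL-Probability.Probability"
begin

text \<open>
  Elements of \<open>C([0,T], \<real>)\<close> are represented as functions on \<open>{0..T}\<close> that take the value
  \<open>undefined\<close> outside \<open>{0..T}\<close>. The \<open>\<sigma>\<close>-algebra is the trace of the product one, so it is
  generated by the coordinate maps; it coincides with the Borel \<open>\<sigma>\<close>-algebra of the sup norm.
  The measure component of \<open>path_space T\<close> itself carries no meaning.
\<close>

definition path_space :: "real \<Rightarrow> (real \<Rightarrow> real) measure" where
  "path_space T = restrict_space (\<Pi>\<^sub>M t\<in>{0..T}. borel) {\<omega>. continuous_on {0..T} \<omega>}"

lemma space_path_space:
  "space (path_space T) = {\<omega> \<in> extensional {0..T}. continuous_on {0..T} \<omega>}"
  by (auto simp: path_space_def space_restrict_space space_PiM PiE_def)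

lemma measurable_coordinate [measurable]:
  assumes "t \<in> {0..T}"
  shows "(\<lambda>\<omega>. \<omega> t) \<in> borel_measurable (path_space T)"
  unfolding path_space_def using assms
  by (intro measurable_restrict_space1 measurable_component_singleton)

definition coordinate_events :: "real \<Rightarrow> real \<Rightarrow> (real \<Rightarrow> real) set set" where
  "coordinate_events T t =
     {(\<lambda>\<omega>. \<omega> s) -` A \<inter> space (path_space T) | s A. s \<in> {0..t} \<and> A \<in> sets borel}"

text \<open>
  Wiener measure on \<open>C([0,T], \<real>)\<close> started at \<open>x\<close>: the law under which the coordinate process
  starts at \<open>x\<close> and has, for \<open>s < t\<close>, an increment over \<open>[s,t]\<close> that is independent of the
  past up to \<open>s\<close> and centred Gaussian with variance \<open>t - s\<close>.
\<close>

definition wiener_measure :: "real \<Rightarrow> real \<Rightarrow> (real \<Rightarrow> real) measure \<Rightarrow> bool" where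
  "wiener_measure T x P \<longleftrightarrow>
     prob_space P \<and>
     space P = space (path_space T) \<and>
     sets P = sets (path_space T) \<and>
     (AE \<omega> in P. \<omega> 0 = x) \<and>
     (\<forall>s t. 0 \<le> s \<and> s < t \<and> t \<le> T \<longrightarrow>
        distributed P lborel (\<lambda>\<omega>. \<omega> t - \<omega> s) (normal_density 0 (sqrt (t - s))) \<and>
        prob_space.indep_set P
          (sigma_sets (space P) (coordinate_events T s))
          {(\<lambda>\<omega>. \<omega> t - \<omega> s) -` A \<inter> space P | A. A \<in> sets borel})"

text \<open>
  The filtration generated by the coordinate process, completed by all \<open>P\<close>-negligible sets,
  i.e. by all subsets of measurable sets of \<open>P\<close>-measure zero.
\<close>

definition completed_filtration ::
    "real \<Rightarrow> (real \<Rightarrow> real) measure \<Rightarrow> real \<Rightarrow> (real \<Rightarrow> real) measure" where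
  "completed_filtration T P t =
     sigma (space (path_space T)) (coordinate_events T t \<union> null_sets (completion P))"

lemma coordinate_events_subset:
  assumes "t \<in> {0..T}"
  shows "coordinate_events T t \<subseteq> sets (path_space T)"
proof
  fix E assume "E \<in> coordinate_events T t"
  then obtain s A where E: "E = (\<lambda>\<omega>. \<omega> s) -` A \<inter> space (path_space T)"
    and s: "s \<in> {0..t}" and A: "A \<in> sets borel"
    unfolding coordinate_events_def by blast
  have "s \<in> {0..T}" using s assms by auto
  from measurable_sets[OF measurable_coordinate[OF this] A] show "E \<in> sets (path_space T)"
    unfolding E .
qed

lemma subalgebra_completed_filtration:
  assumes P: "wiener_measure T x P" and t: "t \<in> {0..T}"
  shows "subalgebra (completion P) (completed_filtration T P t)"
proof -
  let ?G = "coordinate_events T t \<union> null_sets (completion P)"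
  have sp: "space P = space (path_space T)" and se: "sets P = sets (path_space T)"
    using P by (simp_all add: wiener_measure_def)
  have sub: "?G \<subseteq> sets (completion P)"
  proof (rule Un_least)
    show "coordinate_events T t \<subseteq> sets (completion P)"
      using coordinate_events_subset[OF t] sets_completionI_sets[of _ P] unfolding se by blast
    show "null_sets (completion P) \<subseteq> sets (completion P)"
      by (rule subsetI) (rule null_setsD2)
  qed
  have pow: "?G \<subseteq> Pow (space (path_space T))"
    using sub sets.space_closed[of "completion P"] unfolding space_completion sp by (rule subset_trans)
  have sig: "sigma_sets (space (path_space T)) ?G \<subseteq> sets (completion P)"
    using sets.sigma_sets_subset[OF sub] unfolding space_completion sp .
  show ?thesis
    unfolding subalgebra_def completed_filtration_def space_completion
      space_measure_of[OF pow] sets_measure_of[OF pow]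
    by (intro conjI sp[symmetric] sig)
qed

text \<open>
  \<open>Z\<close> is a continuous version of the martingale \<open>P[A | F\<^sub>t]\<close>, \<open>t \<in> [0,T]\<close>. Adaptedness of
  \<open>Z\<close> is not listed separately: as each \<open>F\<^sub>t\<close> contains all negligible sets, it follows from
  the almost sure equality.
\<close>

definition continuous_cond_prob ::
    "real \<Rightarrow> (real \<Rightarrow> real) measure \<Rightarrow> (real \<Rightarrow> real) set \<Rightarrow> (real \<Rightarrow> (real \<Rightarrow> real) \<Rightarrow> real) \<Rightarrow> bool"
  where
  "continuous_cond_prob T P A Z \<longleftrightarrow>
     (\<forall>t\<in>{0..T}. AE \<omega> in completion P.
        Z t \<omega> = real_cond_exp (completion P) (completed_filtration T P t) (indicator A) \<omega>) \<and>
     (AE \<omega> in completion P. continuous_on {0..T} (\<lambda>t. Z t \<omega>))"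

definition path_ball :: "real \<Rightarrow> real \<Rightarrow> real \<Rightarrow> (real \<Rightarrow> real) set" where
  "path_ball T m r = {\<omega> \<in> space (path_space T). (SUP t\<in>{0..T}. \<bar>\<omega> t - m\<bar>) \<le> r}"

lemma path_ball_measurable:
  assumes "T > 0"
  shows "path_ball T m r \<in> sets (path_space T)"
proof -
  obtain D where D: "countable D" "D \<subseteq> {0..T}" "{0..T} \<subseteq> closure D"
    by (rule separable)
  have sup_iff: "(SUP t\<in>{0..T}. \<bar>\<omega> t - m\<bar>) \<le> r \<longleftrightarrow> (\<forall>t\<in>D. \<bar>\<omega> t - m\<bar> \<le> r)"
    if "\<omega> \<in> space (path_space T)" for \<omega>
  proof -
    have cont: "continuous_on {0..T} (\<lambda>t. \<bar>\<omega> t - m\<bar>)"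
      using that by (auto simp: space_path_space intro!: continuous_intros)
    have "bdd_above ((\<lambda>t. \<bar>\<omega> t - m\<bar>) ` {0..T})"
      by (intro bounded_imp_bdd_above compact_imp_bounded compact_continuous_image cont compact_Icc)
    then have "(SUP t\<in>{0..T}. \<bar>\<omega> t - m\<bar>) \<le> r \<longleftrightarrow> (\<forall>t\<in>{0..T}. \<bar>\<omega> t - m\<bar> \<le> r)"
      using assms by (intro cSUP_le_iff) auto
    also have "\<dots> \<longleftrightarrow> (\<forall>t\<in>D. \<bar>\<omega> t - m\<bar> \<le> r)"
    proof
      assume *: "\<forall>t\<in>D. \<bar>\<omega> t - m\<bar> \<le> r"
      have "closed ({0..T} \<inter> (\<lambda>t. \<bar>\<omega> t - m\<bar>) -` {..r})"
        by (intro continuous_closed_preimage cont closed_atLeastAtMost closed_atMost)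
      moreover have "D \<subseteq> {0..T} \<inter> (\<lambda>t. \<bar>\<omega> t - m\<bar>) -` {..r}"
        using * D(2) by auto
      ultimately have "closure D \<subseteq> {0..T} \<inter> (\<lambda>t. \<bar>\<omega> t - m\<bar>) -` {..r}"
        by (rule closure_minimal[rotated])
      with D(3) show "\<forall>t\<in>{0..T}. \<bar>\<omega> t - m\<bar> \<le> r"
        by blast
    qed (use D(2) in blast)
    finally show ?thesis .
  qed
  have "path_ball T m r = {\<omega> \<in> space (path_space T). \<forall>t\<in>D. \<bar>\<omega> t - m\<bar> \<le> r}"
    unfolding path_ball_def using sup_iff by blast
  also have "\<dots> \<in> sets (path_space T)"
  proof (intro sets.sets_Collect_countable_All' D(1))
    fix t assume "t \<in> D"
    with D(2) have [measurable]: "(\<lambda>\<omega>. \<omega> t) \<in> borel_measurable (path_space T)"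
      by (intro measurable_coordinate) blast
    show "{\<omega> \<in> space (path_space T). \<bar>\<omega> t - m\<bar> \<le> r} \<in> sets (path_space T)"
      by measurable
  qed
  finally show ?thesis .
qed

abbreviation path_ball_compl :: "real \<Rightarrow> real \<Rightarrow> real \<Rightarrow> (real \<Rightarrow> real) set" where
  "path_ball_compl T m r \<equiv> space (path_space T) - path_ball T m r"

end

theory Submission
  imports Defs
begin

text \<open>
  A path outside the ball satisfies \<open>\<bar>\<omega> s - m\<bar> > r\<close> for some \<open>s < T\<close>; this is known from time
  \<open>s\<close> on, so \<open>P\<^sub>t[B] = 0\<close> for \<open>t \<ge> s\<close>. A path in the ball almost surely ends strictly inside
  it, so near \<open>T\<close> it stays at distance at least some \<open>\<delta> > 0\<close> from the boundary, and \<open>P\<^sub>t[B\<^sup>c]\<close>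
  is at most the probability that the increments after \<open>t\<close> reach \<open>\<delta>\<close>. By Levy's maximal
  inequality and Chebyshev's inequality this is at most \<open>2 (T - t) / \<delta>\<^sup>2\<close>, which is
  \<open>O((T - t)\<^bsup>p-1\<^esup>)\<close> as \<open>p < 2\<close>. Almost sure statements are obtained at rational times and
  extended by continuity.
\<close>

section \<open>Functions on an interval\<close>

text \<open>The set where \<open>f\<close> is at most \<open>c\<close> is closed and contains the
  rationals of the open interval, which are dense in the closed one. This turns bounds known off one
  null set at countably many times into bounds at all times.\<close>

lemma continuous_on_le_of_rationals:
  fixes f :: "real \<Rightarrow> real"
  assumes "a < b" and cont: "continuous_on {a..b} f"
    and le: "\<And>u. u \<in> \<rat> \<Longrightarrow> a < u \<Longrightarrow> u < b \<Longrightarrow> f u \<le> c" and t: "t \<in> {a..b}"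
  shows "f t \<le> c"
proof -
  have "closed ({a..b} \<inter> f -` {..c})"
    by (intro continuous_closed_preimage cont closed_atLeastAtMost closed_atMost)
  moreover have "{a<..<b} \<inter> \<rat> \<subseteq> {a..b} \<inter> f -` {..c}"
    using le by auto
  ultimately have "closure ({a<..<b} \<inter> \<rat>) \<subseteq> {a..b} \<inter> f -` {..c}"
    by (rule closure_minimal[rotated])
  moreover have "closure ({a<..<b} \<inter> \<rat>) = closure {a<..<b}"
    by (rule closure_open_Int_superset) (auto simp: Rats_closure_real)
  ultimately show ?thesis
    using t \<open>a < b\<close> by (auto simp: closure_greaterThanLessThan)
qed

text \<open>Only the behaviour near \<open>T\<close> matters: up to time \<open>a\<close> the
  numerator is bounded by compactness and the denominator is at least \<open>(T - a) powr q\<close>.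
  The supremum is taken in \<open>ereal\<close>, where an unbounded family has the value infinity,
  so finiteness is a genuine statement.\<close>

lemma SUP_divide_powr_finite:
  fixes f :: "real \<Rightarrow> real"
  assumes cont: "continuous_on {0..T} f" and "0 \<le> a" "a < T" "0 \<le> q"
    and le: "\<And>t. a \<le> t \<Longrightarrow> t < T \<Longrightarrow> f t \<le> C * (T - t) powr q"
  shows "(SUP t\<in>{0..<T}. ereal (f t / (T - t) powr q)) < \<infinity>"
proof -
  have "bounded (f ` {0..T})"
    by (intro compact_imp_bounded compact_continuous_image cont compact_Icc)
  then obtain M where M: "\<And>t. t \<in> {0..T} \<Longrightarrow> \<bar>f t\<bar> \<le> M"
    unfolding bounded_real by (metis imageI)
  have "f t / (T - t) powr q \<le> max C (M / (T - a) powr q)" if t: "t \<in> {0..<T}" for t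
  proof (cases "a \<le> t")
    case True
    then have "f t / (T - t) powr q \<le> C"
      using le[of t] t by (simp add: divide_le_eq)
    then show ?thesis by simp
  next
    case False
    have "f t / (T - t) powr q \<le> \<bar>f t\<bar> / (T - t) powr q"
      by (intro divide_right_mono) auto
    also have "\<dots> \<le> M / (T - a) powr q"
      using False assms(2-4) t M[of t] by (intro frac_le powr_mono2) auto
    finally show ?thesis by simp
  qed
  then have "(SUP t\<in>{0..<T}. ereal (f t / (T - t) powr q)) \<le> ereal (max C (M / (T - a) powr q))"
    by (intro SUP_least) (simp del: ereal_max)
  then show ?thesis
    by (rule le_less_trans) (simp del: ereal_max)
qed

section \<open>Conditional probabilities and Gaussian tails\<close>

text \<open>The conditional probability is tested on the exceptional set \<open>H\<close>, the part
  of \<open>G\<close> where it exceeds \<open>c\<close>. The hypothesis for this \<open>H\<close>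
  forces the integral of the nonnegative function
  \<open>indicator H \<omega> * (?Z \<omega> - c)\<close> to vanish, so the function is zero almost
  surely.\<close>

lemma (in finite_measure_subalgebra) cond_prob_le:
  assumes G: "G \<in> sets F" and B: "B \<in> sets M"
    and le: "\<And>H. H \<in> sets F \<Longrightarrow> H \<subseteq> G \<Longrightarrow> measure M (H \<inter> B) \<le> c * measure M H"
  shows "AE \<omega> in M. \<omega> \<in> G \<longrightarrow> real_cond_exp M F (indicator B) \<omega> \<le> c"
proof -
  let ?Z = "real_cond_exp M F (indicator B)"
  define H where "H = {\<omega> \<in> space F. \<omega> \<in> G \<and> c < ?Z \<omega>}"
  have HF: "H \<in> sets F"
    unfolding H_def using G by measurable
  then have [measurable]: "H \<in> sets M"
    using subalg by (auto simp: subalgebra_def)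
  have iB: "integrable M (indicator B :: _ \<Rightarrow> real)"
    using B by (simp add: integrable_indicator_iff emeasure_finite less_top[symmetric])
  have iZ: "integrable M ?Z"
    by (rule real_cond_exp_int(1)[OF iB])
  have iH: "integrable M (\<lambda>\<omega>. indicator H \<omega> * ?Z \<omega>)"
    using integrable_mult_indicator[OF _ iZ, of H] by simp
  have iH': "integrable M (\<lambda>\<omega>. indicator H \<omega> * c)"
    by (simp add: integrable_indicator_iff emeasure_finite less_top[symmetric])
  have "(\<integral>\<omega>. indicator H \<omega> * ?Z \<omega> \<partial>M) = (\<integral>\<omega>. indicator H \<omega> * indicator B \<omega> \<partial>M)"
    using real_cond_exp_intA[OF iB HF] by (simp add: set_lebesgue_integral_def)
  also have "\<dots> = measure M (H \<inter> B)"
    using B sets.sets_into_space[OF B] by (simp add: indicator_inter_arith[symmetric] Int_absorb2 le_infI2)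
  also have "\<dots> \<le> c * measure M H"
    using HF by (rule le) (auto simp: H_def)
  finally have "(\<integral>\<omega>. indicator H \<omega> * (?Z \<omega> - c) \<partial>M) \<le> 0"
    using iH iH' sets.sets_into_space[of H M]
    by (simp add: right_diff_distrib Bochner_Integration.integral_diff Int_absorb2 mult.commute)
  moreover have nn: "0 \<le> indicator H \<omega> * (?Z \<omega> - c)" for \<omega>
    by (auto simp: H_def indicator_def)
  ultimately have "(\<integral>\<omega>. indicator H \<omega> * (?Z \<omega> - c) \<partial>M) = 0"
    by (intro antisym integral_nonneg_AE) auto
  moreover have "integrable M (\<lambda>\<omega>. indicator H \<omega> * (?Z \<omega> - c))"
    using Bochner_Integration.integrable_diff[OF iH iH'] by (simp add: right_diff_distrib)
  ultimately have "AE \<omega> in M. indicator H \<omega> * (?Z \<omega> - c) = 0"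
    using nn by (subst (asm) integral_nonneg_eq_0_iff_AE) auto
  then show ?thesis
    using AE_space subalg by (auto simp: H_def indicator_def subalgebra_def split: if_splits)
qed

text \<open>By symmetry \<open>X\<close> and \<open>-X\<close> have the same law, so the two half
  lines are equally likely; since they cover the line, each has probability at least one
  half.\<close>

lemma (in prob_space) normal_half_lines:
  assumes X: "distributed M lborel X (normal_density 0 \<sigma>)" and \<sigma>: "0 < \<sigma>"
  shows "1/2 \<le> prob {\<omega> \<in> space M. 0 \<le> X \<omega>}" and "1/2 \<le> prob {\<omega> \<in> space M. X \<omega> \<le> 0}"
proof -
  have [measurable]: "X \<in> borel_measurable M"
    using distributed_measurable[OF X] by simp
  have mX: "distributed M lborel (\<lambda>\<omega>. - X \<omega>) (normal_density 0 \<sigma>)"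
    using normal_density_affine[OF X \<sigma>, of "-1" 0] by simp
  have "distr M lborel X = distr M lborel (\<lambda>\<omega>. - X \<omega>)"
    using distributed_distr_eq_density[OF X] distributed_distr_eq_density[OF mX] by simp
  then have "measure (distr M lborel X) {0..} = measure (distr M lborel (\<lambda>\<omega>. - X \<omega>)) {0..}"
    by simp
  then have eq: "prob {\<omega> \<in> space M. 0 \<le> X \<omega>} = prob {\<omega> \<in> space M. X \<omega> \<le> 0}"
    by (simp add: measure_distr vimage_def Int_def conj_commute)
  have "1 = prob ({\<omega> \<in> space M. 0 \<le> X \<omega>} \<union> {\<omega> \<in> space M. X \<omega> \<le> 0})"
    by (subst prob_space[symmetric]) (rule arg_cong[where f=prob], auto)
  also have "\<dots> \<le> prob {\<omega> \<in> space M. 0 \<le> X \<omega>} + prob {\<omega> \<in> space M. X \<omega> \<le> 0}"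
    by (rule measure_Un_le) measurable
  finally show "1/2 \<le> prob {\<omega> \<in> space M. 0 \<le> X \<omega>}" "1/2 \<le> prob {\<omega> \<in> space M. X \<omega> \<le> 0}"
    using eq by simp_all
qed

lemma (in prob_space) normal_tail_le:
  assumes X: "distributed M lborel X (normal_density 0 \<sigma>)" and \<sigma>: "0 < \<sigma>" and e: "0 < e"
  shows "prob {\<omega> \<in> space M. e \<le> \<bar>X \<omega>\<bar>} \<le> \<sigma>\<^sup>2 / e\<^sup>2"
proof -
  have [measurable]: "X \<in> borel_measurable M"
    using distributed_measurable[OF X] by simp
  have "integrable M (\<lambda>\<omega>. (X \<omega>)\<^sup>2)"
    using distributed_integrable[OF X, of "\<lambda>x. x\<^sup>2"] integrable_normal_moment[OF \<sigma>, of 0 2] by simp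
  from Chebyshev_inequality[OF _ this e] show ?thesis
    using normal_distributed_expectation[OF \<sigma> X] normal_distributed_variance[OF \<sigma> X] by simp
qed

section \<open>Wiener measure\<close>

locale wiener =
  fixes T x :: real and P :: "(real \<Rightarrow> real) measure"
  assumes wiener: "wiener_measure T x P" and T_pos: "0 < T"
begin

sublocale prob_space P
  using wiener by (simp add: wiener_measure_def)

text \<open>This is the filtration before completion. Its events are measurable for \<open>P\<close>
  itself, and independence of increments is assumed for it; estimates are proved here and
  transferred to the completed filtration afterwards.\<close>

definition past :: "real \<Rightarrow> (real \<Rightarrow> real) measure" where
  "past t = sigma (space P) (coordinate_events T t)"

lemma space_P: "space P = space (path_space T)" and sets_P: "sets P = sets (path_space T)"
  using wiener by (simp_all add: wiener_measure_def)

lemma coordinate_events_Pow: "coordinate_events T t \<subseteq> Pow (space P)"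
  by (auto simp: coordinate_events_def space_P)

lemma space_past [simp]: "space (past t) = space P"
  using coordinate_events_Pow by (simp add: past_def space_measure_of)

lemma sets_past: "sets (past t) = sigma_sets (space P) (coordinate_events T t)"
  using coordinate_events_Pow by (simp add: past_def sets_measure_of)

lemma past_subset_events: "t \<in> {0..T} \<Longrightarrow> sets (past t) \<subseteq> events"
  unfolding sets_past using coordinate_events_subset sets_P by (intro sets.sigma_sets_subset) auto

lemma past_mono: "s \<le> t \<Longrightarrow> sets (past s) \<subseteq> sets (past t)"
  unfolding sets_past by (intro sigma_sets_mono') (fastforce simp: coordinate_events_def)

lemma measurable_past: "0 \<le> u \<Longrightarrow> u \<le> t \<Longrightarrow> (\<lambda>\<omega>. \<omega> u) \<in> borel_measurable (past t)"
  by (rule measurableI) (auto simp: sets_past coordinate_events_def space_P)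

lemma measurable_P: "0 \<le> u \<Longrightarrow> u \<le> T \<Longrightarrow> (\<lambda>\<omega>. \<omega> u) \<in> borel_measurable P"
  using measurable_coordinate[of u T] by (simp add: measurable_cong_sets[OF sets_P refl])

lemma increment_distributed:
  "0 \<le> s \<Longrightarrow> s < t \<Longrightarrow> t \<le> T \<Longrightarrow>
    distributed P lborel (\<lambda>\<omega>. \<omega> t - \<omega> s) (normal_density 0 (sqrt (t - s)))"
  using wiener by (simp add: wiener_measure_def)

lemma increment_indep:
  assumes "0 \<le> s" "s < t" "t \<le> T" and E: "E \<in> sets (past s)" and A: "A \<in> sets borel"
  shows "prob (E \<inter> {\<omega> \<in> space P. \<omega> t - \<omega> s \<in> A}) = prob E * prob {\<omega> \<in> space P. \<omega> t - \<omega> s \<in> A}"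
proof -
  have "indep_set (sets (past s)) {(\<lambda>\<omega>. \<omega> t - \<omega> s) -` A \<inter> space P | A. A \<in> sets borel}"
    using wiener assms(1-3) unfolding wiener_measure_def sets_past by blast
  from indep_setD[OF this E, of "{\<omega> \<in> space P. \<omega> t - \<omega> s \<in> A}"] A show ?thesis
    by (auto simp: vimage_def Int_def conj_commute)
qed

section \<open>Levy's maximal inequality\<close>

text \<open>The increment over \<open>[s, T]\<close> is independent of \<open>E\<close> and takes
  each sign with probability at least one half. This replaces the reflection principle in the
  maximal inequality.\<close>

lemma increment_half_lines:
  assumes "0 \<le> s" "s < T" and E: "E \<in> sets (past s)"
  shows "prob E \<le> 2 * prob (E \<inter> {\<omega> \<in> space P. 0 \<le> \<omega> T - \<omega> s})"
    and "prob E \<le> 2 * prob (E \<inter> {\<omega> \<in> space P. \<omega> T - \<omega> s \<le> 0})"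
proof -
  have \<sigma>: "0 < sqrt (T - s)" using assms by simp
  note N = increment_distributed[OF assms(1,2) order_refl]
  show "prob E \<le> 2 * prob (E \<inter> {\<omega> \<in> space P. 0 \<le> \<omega> T - \<omega> s})"
    using increment_indep[OF assms(1,2) order_refl E, of "{0..}"]
      mult_left_mono[OF normal_half_lines(1)[OF N \<sigma>], of "prob E"] by simp
  show "prob E \<le> 2 * prob (E \<inter> {\<omega> \<in> space P. \<omega> T - \<omega> s \<le> 0})"
    using increment_indep[OF assms(1,2) order_refl E, of "{..0}"]
      mult_left_mono[OF normal_half_lines(2)[OF N \<sigma>], of "prob E"] by simp
qed

text \<open>
  Levy's maximal inequality. The event is decomposed according to the first \<open>u \<in> S\<close> with
  \<open>\<bar>\<omega> u - \<omega> t\<bar> \<ge> e\<close>; the increment over \<open>[u, T]\<close> then has the same sign as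
  \<open>\<omega> u - \<omega> t\<close> with probability at least one half.
\<close>

lemma maximal_inequality_finite:
  assumes "0 \<le> t" "t < T" and S: "finite S" "S \<subseteq> {t..<T}" and F: "F \<in> sets (past t)" and "0 < e"
  shows "prob (F \<inter> {\<omega> \<in> space P. \<exists>u\<in>S. e \<le> \<bar>\<omega> u - \<omega> t\<bar>})
    \<le> 2 * prob (F \<inter> {\<omega> \<in> space P. e \<le> \<bar>\<omega> T - \<omega> t\<bar>})"
proof -
  define R where "R = {\<omega> \<in> space P. e \<le> \<bar>\<omega> T - \<omega> t\<bar>}"
  \<comment> \<open>\<open>U u\<close> and \<open>L u\<close> say that the threshold is first
    reached at \<open>u\<close>, upwards or downwards. The direction is recorded because it decides
    which sign of the later increment is favourable.\<close>
  define U where "U u = {\<omega> \<in> F. e \<le> \<omega> u - \<omega> t \<and> (\<forall>v\<in>S. v < u \<longrightarrow> \<bar>\<omega> v - \<omega> t\<bar> < e)}" for u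
  define L where "L u = {\<omega> \<in> F. e \<le> \<omega> t - \<omega> u \<and> (\<forall>v\<in>S. v < u \<longrightarrow> \<bar>\<omega> v - \<omega> t\<bar> < e)}" for u
  define D where "D u = U u \<union> L u" for u
  have Fsp: "F \<subseteq> space P"
    using sets.sets_into_space[OF F] by simp
  \<comment> \<open>These events involve only coordinates up to time \<open>u\<close>, so they are
    independent of the increment over \<open>[u, T]\<close>.\<close>
  have past_U: "U u \<in> sets (past u)" and past_L: "L u \<in> sets (past u)" if u: "u \<in> S" for u
  proof -
    have tu: "t \<le> u" using u S by auto
    have [measurable]: "F \<in> sets (past u)"
      using F past_mono[OF tu] by auto
    have [measurable]: "(\<lambda>\<omega>. \<omega> t) \<in> borel_measurable (past u)" "(\<lambda>\<omega>. \<omega> u) \<in> borel_measurable (past u)"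
      using tu assms(1) by (auto intro: measurable_past)
    have *: "{\<omega> \<in> space (past u). \<forall>v\<in>{v\<in>S. v < u}. \<bar>\<omega> v - \<omega> t\<bar> < e} \<in> sets (past u)"
    proof (rule sets.sets_Collect_finite_All)
      fix v assume "v \<in> {v \<in> S. v < u}"
      with S assms(1) have [measurable]: "(\<lambda>\<omega>. \<omega> v) \<in> borel_measurable (past u)"
        by (intro measurable_past) auto
      show "{\<omega> \<in> space (past u). \<bar>\<omega> v - \<omega> t\<bar> < e} \<in> sets (past u)"
        by measurable
    qed (use S in auto)
    have "U u = F \<inter> {\<omega> \<in> space (past u). e \<le> \<omega> u - \<omega> t} \<inter> {\<omega> \<in> space (past u). \<forall>v\<in>{v\<in>S. v < u}. \<bar>\<omega> v - \<omega> t\<bar> < e}"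
      using Fsp by (auto simp: U_def)
    moreover have "{\<omega> \<in> space (past u). e \<le> \<omega> u - \<omega> t} \<in> sets (past u)"
      by measurable
    ultimately show "U u \<in> sets (past u)"
      using * \<open>F \<in> sets (past u)\<close> by (simp only: sets.Int)
    have "L u = F \<inter> {\<omega> \<in> space (past u). e \<le> \<omega> t - \<omega> u} \<inter> {\<omega> \<in> space (past u). \<forall>v\<in>{v\<in>S. v < u}. \<bar>\<omega> v - \<omega> t\<bar> < e}"
      using Fsp by (auto simp: L_def)
    moreover have "{\<omega> \<in> space (past u). e \<le> \<omega> t - \<omega> u} \<in> sets (past u)"
      by measurable
    ultimately show "L u \<in> sets (past u)"
      using * \<open>F \<in> sets (past u)\<close> by (simp only: sets.Int)
  qed
  have ST: "0 \<le> u \<and> u < T" if "u \<in> S" for u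
    using that S assms(1) by auto
  have [measurable]: "(\<lambda>\<omega>. \<omega> t) \<in> borel_measurable P" "(\<lambda>\<omega>. \<omega> T) \<in> borel_measurable P"
    using assms(1,2) by (auto intro: measurable_P)
  have R [measurable]: "R \<in> events"
    unfolding R_def by measurable
  have evU: "U u \<in> events" and evL: "L u \<in> events" if "u \<in> S" for u
    using past_U[OF that] past_L[OF that] past_subset_events[of u] ST[OF that] by auto
  then have evD: "D u \<in> events" if "u \<in> S" for u
    using that by (simp add: D_def)
  have D_le: "prob (D u) \<le> 2 * prob (D u \<inter> R)" if u: "u \<in> S" for u
  proof -
    have "prob (U u) \<le> 2 * prob (U u \<inter> {\<omega> \<in> space P. 0 \<le> \<omega> T - \<omega> u})"
      using ST[OF u] past_U[OF u] by (intro increment_half_lines) auto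
    \<comment> \<open>On \<open>U u\<close> the path is already at least \<open>e\<close> above its
      value at \<open>t\<close>, and a nonnegative further increment keeps it there at time
      \<open>T\<close>.\<close>
    also have "\<dots> \<le> 2 * prob (U u \<inter> R)"
      using evU[OF u] by (intro mult_left_mono finite_measure_mono) (auto simp: U_def R_def)
    finally have 1: "prob (U u) \<le> 2 * prob (U u \<inter> R)" .
    have "prob (L u) \<le> 2 * prob (L u \<inter> {\<omega> \<in> space P. \<omega> T - \<omega> u \<le> 0})"
      using ST[OF u] past_L[OF u] by (intro increment_half_lines) auto
    also have "\<dots> \<le> 2 * prob (L u \<inter> R)"
      using evL[OF u] by (intro mult_left_mono finite_measure_mono) (auto simp: L_def R_def)
    finally have 2: "prob (L u) \<le> 2 * prob (L u \<inter> R)" .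
    have "U u \<inter> L u = {}"
      using \<open>0 < e\<close> by (auto simp: U_def L_def)
    then have "prob (D u) = prob (U u) + prob (L u)"
      "prob (D u \<inter> R) = prob (U u \<inter> R) + prob (L u \<inter> R)"
      using evU[OF u] evL[OF u] R unfolding D_def Int_Un_distrib2
      by (auto intro!: finite_measure_Union)
    with 1 2 show ?thesis by simp
  qed
  \<comment> \<open>Of two distinct times, the event of the later one demands that the threshold was
    not reached at the earlier one.\<close>
  have disj: "disjoint_family_on D S"
    unfolding disjoint_family_on_def
  proof (intro ballI impI)
    fix u v assume "u \<in> S" "v \<in> S" "u \<noteq> v"
    then show "D u \<inter> D v = {}"
      by (cases u v rule: linorder_cases) (fastforce simp: D_def U_def L_def)+
  qed
  have "F \<inter> {\<omega> \<in> space P. \<exists>u\<in>S. e \<le> \<bar>\<omega> u - \<omega> t\<bar>} \<subseteq> (\<Union>u\<in>S. D u)"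
  proof
    fix \<omega> assume \<omega>: "\<omega> \<in> F \<inter> {\<omega> \<in> space P. \<exists>u\<in>S. e \<le> \<bar>\<omega> u - \<omega> t\<bar>}"
    define V where "V = {u \<in> S. e \<le> \<bar>\<omega> u - \<omega> t\<bar>}"
    have V: "finite V" "V \<noteq> {}"
      using \<omega> S by (auto simp: V_def)
    from Min_in[OF V] have "Min V \<in> S" "e \<le> \<bar>\<omega> (Min V) - \<omega> t\<bar>"
      by (auto simp: V_def)
    moreover have "\<bar>\<omega> v - \<omega> t\<bar> < e" if "v \<in> S" "v < Min V" for v
      using that Min_le[OF V(1), of v] by (force simp: V_def)
    ultimately have "\<omega> \<in> D (Min V)"
      using \<omega> by (auto simp: D_def U_def L_def abs_if split: if_splits)
    with \<open>Min V \<in> S\<close> show "\<omega> \<in> (\<Union>u\<in>S. D u)" by blast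
  qed
  then have "prob (F \<inter> {\<omega> \<in> space P. \<exists>u\<in>S. e \<le> \<bar>\<omega> u - \<omega> t\<bar>}) \<le> prob (\<Union>u\<in>S. D u)"
    using evD S by (intro finite_measure_mono) auto
  also have "\<dots> = (\<Sum>u\<in>S. prob (D u))"
    using evD S disj by (intro finite_measure_finite_Union) auto
  also have "\<dots> \<le> (\<Sum>u\<in>S. 2 * prob (D u \<inter> R))"
    by (intro sum_mono D_le)
  also have "\<dots> = 2 * prob (\<Union>u\<in>S. D u \<inter> R)"
    using evD S R disj
    by (subst finite_measure_finite_Union) (auto simp: sum_distrib_left intro!: disjoint_family_on_bisimulation[OF disj])
  also have "\<dots> \<le> 2 * prob (F \<inter> R)"
    using F past_subset_events[of t] assms(1,2) R
    by (intro mult_left_mono finite_measure_mono) (auto simp: D_def U_def L_def)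
  finally show ?thesis by (simp add: R_def)
qed

text \<open>A countable \<open>S\<close> is exhausted by finite sets, and the bound passes to the
  limit by continuity from below. For finite sets, independence splits off the factor
  \<open>prob F\<close> and Chebyshev's inequality bounds the terminal increment. Having
  \<open>prob F\<close> on the right for every past event \<open>F\<close> is what makes this a
  conditional estimate.\<close>

lemma maximal_inequality:
  assumes "0 \<le> t" "t < T" and S: "countable S" "S \<subseteq> {t..<T}" and F: "F \<in> sets (past t)" and "0 < e"
  shows "prob (F \<inter> {\<omega> \<in> space P. \<exists>u\<in>S. e \<le> \<bar>\<omega> u - \<omega> t\<bar>}) \<le> 2 * (T - t) / e\<^sup>2 * prob F"
proof (cases "S = {}")
  case True
  then show ?thesis using assms by simp
next
  case False
  define A where "A n = F \<inter> {\<omega> \<in> space P. \<exists>u\<in>from_nat_into S ` {..n}. e \<le> \<bar>\<omega> u - \<omega> t\<bar>}" for n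
  have F_ev: "F \<in> events"
    using F past_subset_events[of t] assms(1,2) by auto
  have "from_nat_into S ` {..n} \<subseteq> S" for n
    using from_nat_into[OF False] by auto
  then have in_S: "from_nat_into S ` {..n} \<subseteq> {t..<T}" for n
    using S by blast
  have A_ev: "A n \<in> events" for n
  proof -
    have "{\<omega> \<in> space P. \<exists>u\<in>from_nat_into S ` {..n}. e \<le> \<bar>\<omega> u - \<omega> t\<bar>} \<in> events"
    proof (rule sets.sets_Collect_finite_Ex)
      fix u assume "u \<in> from_nat_into S ` {..n}"
      then have [measurable]: "(\<lambda>\<omega>. \<omega> u) \<in> borel_measurable P" "(\<lambda>\<omega>. \<omega> t) \<in> borel_measurable P"
        using in_S[of n] assms(1,2) by (auto intro!: measurable_P)
      show "{\<omega> \<in> space P. e \<le> \<bar>\<omega> u - \<omega> t\<bar>} \<in> events" by measurable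
    qed simp
    with F_ev show ?thesis by (simp add: A_def)
  qed
  have A_le: "prob (A n) \<le> 2 * (T - t) / e\<^sup>2 * prob F" for n
  proof -
    have "prob (A n) \<le> 2 * prob (F \<inter> {\<omega> \<in> space P. e \<le> \<bar>\<omega> T - \<omega> t\<bar>})"
      unfolding A_def using assms(1,2) in_S F \<open>0 < e\<close> by (intro maximal_inequality_finite) auto
    also have "prob (F \<inter> {\<omega> \<in> space P. e \<le> \<bar>\<omega> T - \<omega> t\<bar>})
        = prob F * prob {\<omega> \<in> space P. e \<le> \<bar>\<omega> T - \<omega> t\<bar>}"
      using increment_indep[OF assms(1,2) order_refl F, of "{y. e \<le> \<bar>y\<bar>}"] by simp
    also have "prob {\<omega> \<in> space P. e \<le> \<bar>\<omega> T - \<omega> t\<bar>} \<le> (sqrt (T - t))\<^sup>2 / e\<^sup>2"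
      using assms(2) \<open>0 < e\<close>
      by (intro normal_tail_le increment_distributed[OF assms(1,2) order_refl]) auto
    finally have "prob (A n) \<le> 2 * (prob F * ((sqrt (T - t))\<^sup>2 / e\<^sup>2))"
      by (simp add: mult_left_mono)
    then show ?thesis
      using assms(2) by (simp add: algebra_simps)
  qed
  have "(\<lambda>n. prob (A n)) \<longlonglongrightarrow> prob (\<Union>n. A n)"
    using A_ev by (intro finite_Lim_measure_incseq) (auto simp: incseq_def A_def)
  moreover have "(\<Union>n. from_nat_into S ` {..n}) = S"
    using range_from_nat_into[OF False S(1)] by (simp flip: image_UN add: UN_atMost_UNIV)
  then have "F \<inter> {\<omega> \<in> space P. \<exists>u\<in>S. e \<le> \<bar>\<omega> u - \<omega> t\<bar>}
      = F \<inter> {\<omega> \<in> space P. \<exists>u\<in>(\<Union>n. from_nat_into S ` {..n}). e \<le> \<bar>\<omega> u - \<omega> t\<bar>}"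
    by simp
  then have "F \<inter> {\<omega> \<in> space P. \<exists>u\<in>S. e \<le> \<bar>\<omega> u - \<omega> t\<bar>} = (\<Union>n. A n)"
    by (auto simp: A_def)
  ultimately show ?thesis
    using A_le by (intro LIMSEQ_le_const2[where X="\<lambda>n. prob (A n)"]) auto
qed

section \<open>Passage to the completed filtration\<close>

lemma sets_completed_filtration:
  "sets (completed_filtration T P t) =
    sigma_sets (space P) (coordinate_events T t \<union> null_sets (completion P))"
proof -
  have "coordinate_events T t \<union> null_sets (completion P) \<subseteq> Pow (space (path_space T))"
    using coordinate_events_Pow sets.sets_into_space[of _ "completion P"]
    by (auto simp: space_P null_sets_def)
  then show ?thesis
    by (simp add: completed_filtration_def space_P sets_measure_of)
qed

text \<open>Almost sure equality with a past event holds for the generators, a null set being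
  matched with the empty set, and it survives complements and countable unions. Independence of
  increments thereby becomes usable for the completed filtration.\<close>

lemma completed_filtration_eq_past:
  assumes t: "t \<in> {0..T}" and H: "H \<in> sets (completed_filtration T P t)"
  obtains H' where "H' \<in> sets (past t)" "AE \<omega> in completion P. \<omega> \<in> H \<longleftrightarrow> \<omega> \<in> H'"
proof -
  have "H \<in> sigma_sets (space P) (coordinate_events T t \<union> null_sets (completion P))"
    using H by (simp add: sets_completed_filtration)
  then have "\<exists>H'\<in>sets (past t). AE \<omega> in completion P. \<omega> \<in> H \<longleftrightarrow> \<omega> \<in> H'"
  proof induction
    case (Basic a)
    then show ?case
    proof
      assume "a \<in> coordinate_events T t"
      then show ?thesis by (intro bexI[of _ a]) (auto simp: sets_past)
    next
      assume "a \<in> null_sets (completion P)"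
      from AE_not_in[OF this] show ?thesis by (intro bexI[of _ "{}"]) auto
    qed
  next
    case Empty
    show ?case by (intro bexI[of _ "{}"]) auto
  next
    case (Compl a)
    then obtain H' where "H' \<in> sets (past t)" "AE \<omega> in completion P. \<omega> \<in> a \<longleftrightarrow> \<omega> \<in> H'"
      by blast
    then show ?case
      by (intro bexI[of _ "space (past t) - H'"] sets.compl_sets) (auto simp del: space_past simp: space_past[symmetric, of t])
  next
    case (Union a)
    then obtain H' where "\<And>i. H' i \<in> sets (past t)" "\<And>i. AE \<omega> in completion P. \<omega> \<in> a i \<longleftrightarrow> \<omega> \<in> H' i"
      by metis
    moreover from this(2) have "AE \<omega> in completion P. \<forall>i. \<omega> \<in> a i \<longleftrightarrow> \<omega> \<in> H' i"
      by (simp add: AE_all_countable)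
    ultimately show ?case
      by (intro bexI[of _ "\<Union>i. H' i"]) auto
  qed
  with that show ?thesis by blast
qed

text \<open>An event of the completed filtration differs from a past event by a null set, so it
  suffices to test on past events.\<close>

lemma cond_prob_le:
  assumes t: "t \<in> {0..T}" and G: "G \<in> sets (past t)" and B: "B \<in> events"
    and le: "\<And>H. H \<in> sets (past t) \<Longrightarrow> H \<subseteq> G \<Longrightarrow> prob (H \<inter> B) \<le> c * prob H"
  shows "AE \<omega> in completion P. \<omega> \<in> G \<longrightarrow>
    real_cond_exp (completion P) (completed_filtration T P t) (indicator B) \<omega> \<le> c"
proof -
  interpret completion_P: prob_space "completion P"
    by (rule prob_space_completion)
  interpret C: finite_measure_subalgebra "completion P" "completed_filtration T P t"
    by unfold_locales (rule subalgebra_completed_filtration[OF wiener t])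
  show ?thesis
  proof (rule C.cond_prob_le)
    have "sets (past t) \<subseteq> sets (completed_filtration T P t)"
      unfolding sets_past sets_completed_filtration by (intro sigma_sets_mono') auto
    with G show "G \<in> sets (completed_filtration T P t)" by blast
    show "B \<in> sets (completion P)" using B by simp
    fix H assume H: "H \<in> sets (completed_filtration T P t)" "H \<subseteq> G"
    obtain H' where H': "H' \<in> sets (past t)" "AE \<omega> in completion P. \<omega> \<in> H \<longleftrightarrow> \<omega> \<in> H'"
      using completed_filtration_eq_past[OF t H(1)] .
    have ev: "H' \<in> events" "G \<in> events"
      using H' G past_subset_events[OF t] by auto
    have HC: "H \<in> sets (completion P)"
      using H(1) C.subalg by (auto simp: subalgebra_def)
    \<comment> \<open>\<open>H'\<close> need not lie inside \<open>G\<close>, as the hypothesis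
      \<open>le\<close> requires. It is cut down to \<open>H' \<inter> G\<close>, which still agrees
      with \<open>H\<close> almost surely because \<open>H \<subseteq> G\<close>.\<close>
    have "measure (completion P) (H \<inter> B) = measure (completion P) (H' \<inter> G \<inter> B)"
      using H'(2) H(2) HC B ev by (intro completion_P.finite_measure_eq_AE) auto
    also have "\<dots> = prob (H' \<inter> G \<inter> B)"
      using B ev by simp
    also have "\<dots> \<le> c * prob (H' \<inter> G)"
      using H'(1) G by (intro le) auto
    also have "prob (H' \<inter> G) = measure (completion P) (H' \<inter> G)"
      using ev by simp
    also have "\<dots> = measure (completion P) H"
      using H'(2) H(2) HC B ev by (intro completion_P.finite_measure_eq_AE) auto
    finally show "measure (completion P) (H \<inter> B) \<le> c * measure (completion P) H" .
  qed
qed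

section \<open>Conditional probabilities of the path ball\<close>

lemma path_space_continuous_on: "\<omega> \<in> space P \<Longrightarrow> a \<ge> 0 \<Longrightarrow> b \<le> T \<Longrightarrow> continuous_on {a..b} \<omega>"
  by (rule continuous_on_subset[of "{0..T}"]) (auto simp: space_P space_path_space)

text \<open>A real supremum controls its terms only when they are bounded above; continuity on a
  compact interval provides this.\<close>

lemma mem_path_ball_iff:
  assumes \<omega>: "\<omega> \<in> space P"
  shows "\<omega> \<in> path_ball T m r \<longleftrightarrow> (\<forall>u\<in>{0..T}. \<bar>\<omega> u - m\<bar> \<le> r)"
proof -
  have "continuous_on {0..T} (\<lambda>u. \<bar>\<omega> u - m\<bar>)"
    using path_space_continuous_on[OF \<omega>, of 0 T] by (auto intro!: continuous_intros)
  then have "bdd_above ((\<lambda>u. \<bar>\<omega> u - m\<bar>) ` {0..T})"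
    by (intro bounded_imp_bdd_above compact_imp_bounded compact_continuous_image compact_Icc)
  then have "(SUP u\<in>{0..T}. \<bar>\<omega> u - m\<bar>) \<le> r \<longleftrightarrow> (\<forall>u\<in>{0..T}. \<bar>\<omega> u - m\<bar> \<le> r)"
    using T_pos by (intro cSUP_le_iff) auto
  then show ?thesis
    using \<omega> by (simp add: path_ball_def space_P)
qed

text \<open>By continuity a path outside the ball violates the bound at a rational time strictly
  between 0 and \<open>T\<close>. So only countably many coordinates matter, and an exit is visible
  before time \<open>T\<close>.\<close>

lemma mem_path_ball_rationals:
  assumes \<omega>: "\<omega> \<in> space P"
  shows "\<omega> \<in> path_ball T m r \<longleftrightarrow> (\<forall>u\<in>\<rat> \<inter> {0<..<T}. \<bar>\<omega> u - m\<bar> \<le> r)"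
proof
  assume *: "\<forall>u\<in>\<rat> \<inter> {0<..<T}. \<bar>\<omega> u - m\<bar> \<le> r"
  have "continuous_on {0..T} (\<lambda>u. \<bar>\<omega> u - m\<bar>)"
    using path_space_continuous_on[OF \<omega>, of 0 T] by (auto intro!: continuous_intros)
  from continuous_on_le_of_rationals[OF T_pos this] * show "\<omega> \<in> path_ball T m r"
    by (auto simp: mem_path_ball_iff[OF \<omega>])
qed (auto simp: mem_path_ball_iff[OF \<omega>])

text \<open>On the conditioning event the path has stayed in the ball up to \<open>t\<close> and is
  at distance at least \<open>d\<close> from the boundary, so leaving later requires an increment of
  size at least \<open>d\<close> after \<open>t\<close>. Rational times keep this event in
  \<open>past t\<close>.\<close>

lemma cond_prob_path_ball_compl_le:
  assumes t: "0 < t" "t < T" and "0 < d"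
  shows "AE \<omega> in completion P. \<bar>\<omega> t - m\<bar> \<le> r - d \<and> (\<forall>u\<in>\<rat> \<inter> {0<..t}. \<bar>\<omega> u - m\<bar> \<le> r) \<longrightarrow>
    real_cond_exp (completion P) (completed_filtration T P t) (indicator (path_ball_compl T m r)) \<omega>
      \<le> 2 * (T - t) / d\<^sup>2"
proof -
  define G where "G = {\<omega> \<in> space P. \<bar>\<omega> t - m\<bar> \<le> r - d \<and> (\<forall>u\<in>\<rat> \<inter> {0<..t}. \<bar>\<omega> u - m\<bar> \<le> r)}"
  define S where "S = \<rat> \<inter> {t..<T}"
  have "AE \<omega> in completion P. \<omega> \<in> G \<longrightarrow>
    real_cond_exp (completion P) (completed_filtration T P t) (indicator (path_ball_compl T m r)) \<omega>
      \<le> 2 * (T - t) / d\<^sup>2"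
  proof (rule cond_prob_le)
    show "t \<in> {0..T}" using t by simp
    have [measurable]: "(\<lambda>\<omega>. \<omega> t) \<in> borel_measurable (past t)"
      using t by (intro measurable_past) auto
    have "{\<omega> \<in> space (past t). \<forall>u\<in>\<rat> \<inter> {0<..t}. \<bar>\<omega> u - m\<bar> \<le> r} \<in> sets (past t)"
    proof (rule sets.sets_Collect_countable_All')
      fix u assume "u \<in> \<rat> \<inter> {0<..t}"
      then have [measurable]: "(\<lambda>\<omega>. \<omega> u) \<in> borel_measurable (past t)"
        by (intro measurable_past) auto
      show "{\<omega> \<in> space (past t). \<bar>\<omega> u - m\<bar> \<le> r} \<in> sets (past t)" by measurable
    qed (auto simp: countable_rat)
    moreover have "{\<omega> \<in> space (past t). \<bar>\<omega> t - m\<bar> \<le> r - d} \<in> sets (past t)"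
      by measurable
    ultimately have "{\<omega> \<in> space (past t). \<bar>\<omega> t - m\<bar> \<le> r - d} \<inter>
        {\<omega> \<in> space (past t). \<forall>u\<in>\<rat> \<inter> {0<..t}. \<bar>\<omega> u - m\<bar> \<le> r} \<in> sets (past t)"
      by blast
    also have "{\<omega> \<in> space (past t). \<bar>\<omega> t - m\<bar> \<le> r - d} \<inter>
        {\<omega> \<in> space (past t). \<forall>u\<in>\<rat> \<inter> {0<..t}. \<bar>\<omega> u - m\<bar> \<le> r} = G"
      by (auto simp: G_def)
    finally show "G \<in> sets (past t)" .
    show B: "path_ball_compl T m r \<in> events"
      using path_ball_measurable[OF T_pos] by (simp add: sets_P sets.compl_sets)
    fix H assume H: "H \<in> sets (past t)" "H \<subseteq> G"
    have evH: "H \<in> events" using H past_subset_events[of t] t by auto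
    have "H \<inter> path_ball_compl T m r \<subseteq> H \<inter> {\<omega> \<in> space P. \<exists>u\<in>S. d \<le> \<bar>\<omega> u - \<omega> t\<bar>}"
    proof
      fix \<omega> assume \<omega>: "\<omega> \<in> H \<inter> path_ball_compl T m r"
      with H have sp: "\<omega> \<in> space P" and G: "\<omega> \<in> G"
        by (auto simp: G_def)
      have "\<exists>u\<in>\<rat> \<inter> {0<..<T}. \<not> \<bar>\<omega> u - m\<bar> \<le> r"
        using \<omega> mem_path_ball_rationals[OF sp, of m r] by blast
      then obtain u where u: "u \<in> \<rat>" "0 < u" "u < T" "r < \<bar>\<omega> u - m\<bar>"
        by (auto simp only: not_le Int_iff greaterThanLessThan_iff)
      moreover from this G have "t < u"
        by (force simp: G_def)
      \<comment> \<open>Triangle inequality: at \<open>u\<close> the distance to \<open>m\<close>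
        exceeds \<open>r\<close>, while at \<open>t\<close> it is at most
        \<open>r - d\<close>.\<close>
      moreover have "d \<le> \<bar>\<omega> u - \<omega> t\<bar>"
        using u G by (auto simp: G_def)
      ultimately show "\<omega> \<in> H \<inter> {\<omega> \<in> space P. \<exists>u\<in>S. d \<le> \<bar>\<omega> u - \<omega> t\<bar>}"
        using \<omega> sp by (auto simp: S_def intro!: bexI[of _ u])
    qed
    moreover have "{\<omega> \<in> space P. \<exists>u\<in>S. d \<le> \<bar>\<omega> u - \<omega> t\<bar>} \<in> events"
    proof (rule sets.sets_Collect_countable_Ex')
      fix u assume "u \<in> S"
      then have [measurable]: "(\<lambda>\<omega>. \<omega> u) \<in> borel_measurable P" "(\<lambda>\<omega>. \<omega> t) \<in> borel_measurable P"
        using t by (auto simp: S_def intro!: measurable_P)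
      show "{\<omega> \<in> space P. d \<le> \<bar>\<omega> u - \<omega> t\<bar>} \<in> events" by measurable
    qed (auto simp: S_def countable_rat)
    ultimately have "prob (H \<inter> path_ball_compl T m r)
        \<le> prob (H \<inter> {\<omega> \<in> space P. \<exists>u\<in>S. d \<le> \<bar>\<omega> u - \<omega> t\<bar>})"
      using evH by (intro finite_measure_mono) auto
    also have "\<dots> \<le> 2 * (T - t) / d\<^sup>2 * prob H"
      using t H \<open>0 < d\<close> by (intro maximal_inequality) (auto simp: S_def countable_rat)
    finally show "prob (H \<inter> path_ball_compl T m r) \<le> 2 * (T - t) / d\<^sup>2 * prob H" .
  qed
  then show ?thesis
    using AE_space by eventually_elim (auto simp: G_def)
qed

text \<open>The conditioning event is already known at time \<open>t\<close> and is disjoint from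
  the ball, so \<open>cond_prob_le\<close> applies with the constant 0.\<close>

lemma cond_prob_path_ball_le:
  assumes "0 \<le> s" "s \<le> t" "t \<le> T"
  shows "AE \<omega> in completion P. r < \<bar>\<omega> s - m\<bar> \<longrightarrow>
    real_cond_exp (completion P) (completed_filtration T P t) (indicator (path_ball T m r)) \<omega> \<le> 0"
proof -
  define G where "G = {\<omega> \<in> space P. r < \<bar>\<omega> s - m\<bar>}"
  have "AE \<omega> in completion P. \<omega> \<in> G \<longrightarrow>
    real_cond_exp (completion P) (completed_filtration T P t) (indicator (path_ball T m r)) \<omega> \<le> 0"
  proof (rule cond_prob_le)
    show "t \<in> {0..T}" using assms by simp
    have [measurable]: "(\<lambda>\<omega>. \<omega> s) \<in> borel_measurable (past t)"
      using assms by (intro measurable_past) auto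
    have "{\<omega> \<in> space (past t). r < \<bar>\<omega> s - m\<bar>} \<in> sets (past t)" by measurable
    then show "G \<in> sets (past t)" by (simp add: G_def)
    show "path_ball T m r \<in> events"
      using path_ball_measurable[OF T_pos] by (simp add: sets_P)
    fix H assume "H \<subseteq> G"
    have "\<omega> \<notin> path_ball T m r" if "\<omega> \<in> G" for \<omega>
      using that assms mem_path_ball_iff[of \<omega> m r] by (force simp: G_def)
    with \<open>H \<subseteq> G\<close> have "H \<inter> path_ball T m r = {}"
      by blast
    then show "prob (H \<inter> path_ball T m r) \<le> 0 * prob H" by simp
  qed
  then show ?thesis
    using AE_space by eventually_elim (auto simp: G_def)
qed

section \<open>Pathwise bounds near the terminal time\<close>

text \<open>The increment over \<open>[0, T]\<close> has a density and the starting point is almost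
  surely \<open>x\<close>. Used with \<open>m + r\<close> and \<open>m - r\<close>, this excludes
  paths of the ball that end exactly on the boundary.\<close>

lemma AE_terminal_ne: "AE \<omega> in P. \<omega> T \<noteq> y"
proof -
  have [measurable]: "(\<lambda>\<omega>. \<omega> T) \<in> borel_measurable P" "(\<lambda>\<omega>. \<omega> 0) \<in> borel_measurable P"
    using T_pos by (auto intro: measurable_P)
  note D = increment_distributed[OF order_refl T_pos order_refl]
  have "AE z in lborel. z \<noteq> y - x"
    by (rule AE_lborel_singleton)
  then have "AE z in distr P lborel (\<lambda>\<omega>. \<omega> T - \<omega> 0). z \<noteq> y - x"
    unfolding distributed_distr_eq_density[OF D] by (subst AE_density) auto
  then have "AE \<omega> in P. \<omega> T - \<omega> 0 \<noteq> y - x"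
    by (subst (asm) AE_distr_iff) auto
  moreover have "AE \<omega> in P. \<omega> 0 = x"
    using wiener by (simp add: wiener_measure_def)
  ultimately show ?thesis
    by eventually_elim auto
qed

lemma AE_continuous_cond_prob:
  assumes "continuous_cond_prob T P A Z"
  shows "AE \<omega> in P. continuous_on {0..T} (\<lambda>t. Z t \<omega>)"
    and "t \<in> {0..T} \<Longrightarrow> AE \<omega> in completion P.
      Z t \<omega> = real_cond_exp (completion P) (completed_filtration T P t) (indicator A) \<omega>"
  using assms by (auto simp: continuous_cond_prob_def AE_completion_iff)

text \<open>The margin \<open>d\<close> depends on the path, so the conditional bound is first made
  simultaneous in all rational \<open>t\<close> and \<open>d\<close>. That bound does not involve
  \<open>p\<close>, hence one null set serves all exponents.\<close>

lemma SUP_cond_prob_path_ball_compl: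
  assumes X: "continuous_cond_prob T P (path_ball_compl T m r) X"
  shows "AE \<omega> in P. \<omega> \<in> path_ball T m r \<longrightarrow>
    (\<forall>p\<in>{1<..<2}. (SUP t\<in>{0..<T}. ereal (X t \<omega> / (T - t) powr (p - 1))) < \<infinity>)"
proof -
  have "AE \<omega> in P. \<forall>t\<in>\<rat> \<inter> {0<..<T}. \<forall>d\<in>\<rat> \<inter> {0<..}.
    \<bar>\<omega> t - m\<bar> \<le> r - d \<and> (\<forall>u\<in>\<rat> \<inter> {0<..t}. \<bar>\<omega> u - m\<bar> \<le> r) \<longrightarrow> X t \<omega> \<le> 2 * (T - t) / d\<^sup>2"
  proof (subst AE_ball_countable, simp add: countable_rat, intro ballI,
      subst AE_ball_countable, simp add: countable_rat, intro ballI)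
    fix t d :: real assume td: "t \<in> \<rat> \<inter> {0<..<T}" "d \<in> \<rat> \<inter> {0<..}"
    have "AE \<omega> in completion P.
      \<bar>\<omega> t - m\<bar> \<le> r - d \<and> (\<forall>u\<in>\<rat> \<inter> {0<..t}. \<bar>\<omega> u - m\<bar> \<le> r) \<longrightarrow> X t \<omega> \<le> 2 * (T - t) / d\<^sup>2"
      using cond_prob_path_ball_compl_le[of t d m r] AE_continuous_cond_prob(2)[OF X, of t] td
      by auto
    then show "AE \<omega> in P.
      \<bar>\<omega> t - m\<bar> \<le> r - d \<and> (\<forall>u\<in>\<rat> \<inter> {0<..t}. \<bar>\<omega> u - m\<bar> \<le> r) \<longrightarrow> X t \<omega> \<le> 2 * (T - t) / d\<^sup>2"
      by (simp add: AE_completion_iff)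
  qed
  then show ?thesis
    using AE_continuous_cond_prob(1)[OF X] AE_terminal_ne[of "m + r"] AE_terminal_ne[of "m - r"] AE_space
  proof eventually_elim
    case (elim \<omega>)
    show ?case
    proof (intro impI ballI)
      fix p :: real assume p: "p \<in> {1<..<2}" and B: "\<omega> \<in> path_ball T m r"
      have ball: "\<bar>\<omega> u - m\<bar> \<le> r" if "u \<in> {0..T}" for u
        using B that mem_path_ball_iff[OF elim(5)] by blast
      have "\<bar>\<omega> T - m\<bar> < r"
        using ball[of T] T_pos elim(3,4) by auto
      then obtain d where d: "d \<in> \<rat>" "0 < d" "d < r - \<bar>\<omega> T - m\<bar>"
        using Rats_dense_in_real[of 0 "r - \<bar>\<omega> T - m\<bar>"] by auto
      have "continuous_on {0..T} (\<lambda>u. \<bar>\<omega> u - m\<bar>)"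
        using path_space_continuous_on[OF elim(5), of 0 T] by (auto intro!: continuous_intros)
      then have "((\<lambda>u. \<bar>\<omega> u - m\<bar>) \<longlongrightarrow> \<bar>\<omega> T - m\<bar>) (at T within {0..T})"
        using T_pos by (auto simp: continuous_on_def)
      moreover have "\<bar>\<omega> T - m\<bar> < r - d"
        using d by simp
      ultimately have "eventually (\<lambda>u. \<bar>\<omega> u - m\<bar> < r - d) (at T within {0..T})"
        by (rule order_tendstoD(2))
      then obtain h where h: "0 < h" "\<And>u. u \<in> {0..T} \<Longrightarrow> u \<noteq> T \<Longrightarrow> dist u T < h \<Longrightarrow> \<bar>\<omega> u - m\<bar> < r - d"
        by (auto simp: eventually_at)
      \<comment> \<open>From \<open>a\<close> on the path keeps the margin \<open>d\<close>; the
        maximum with 0 keeps \<open>a\<close> inside \<open>[0, T]\<close>.\<close>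
      define a where "a = max 0 (T - h / 2)"
      have a: "0 \<le> a" "a < T"
        using h T_pos by (auto simp: a_def)
      have near: "\<bar>\<omega> u - m\<bar> \<le> r - d" if "a < u" "u < T" for u
        using h(1) h(2)[of u] that by (auto simp: a_def dist_real_def)
      have Xq: "X u \<omega> - 2 * (T - u) / d\<^sup>2 \<le> 0" if "u \<in> \<rat>" "a < u" "u < T" for u
        using elim(1) that a d near[of u] ball by auto
      have Xa: "X t \<omega> \<le> 2 * (T - t) / d\<^sup>2" if t: "a \<le> t" "t < T" for t
      proof -
        have "continuous_on {a..T} (\<lambda>u. X u \<omega> - 2 * (T - u) / d\<^sup>2)"
          using continuous_on_subset[OF elim(2), of "{a..T}"] a d
          by (auto intro!: continuous_intros)
        from continuous_on_le_of_rationals[OF a(2) this Xq, of t] t show ?thesis by simp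
      qed
      show "(SUP t\<in>{0..<T}. ereal (X t \<omega> / (T - t) powr (p - 1))) < \<infinity>"
      proof (rule SUP_divide_powr_finite[OF elim(2) a])
        show "0 \<le> p - 1" using p by simp
        fix t assume t: "a \<le> t" "t < T"
        \<comment> \<open>Here \<open>p < 2\<close> enters: the factor with exponent
          \<open>2 - p\<close> stays bounded, by \<open>T powr (2 - p)\<close>.\<close>
        have "T - t = (T - t) powr (2 - p) * (T - t) powr (p - 1)"
          using t by (simp flip: powr_add)
        also have "\<dots> \<le> T powr (2 - p) * (T - t) powr (p - 1)"
          using t a p by (intro mult_right_mono powr_mono2) auto
        finally have "2 / d\<^sup>2 * (T - t) \<le> 2 / d\<^sup>2 * (T powr (2 - p) * (T - t) powr (p - 1))"
          by (intro mult_left_mono) auto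
        with Xa[OF t] show "X t \<omega> \<le> 2 / d\<^sup>2 * T powr (2 - p) * (T - t) powr (p - 1)"
          by (simp add: mult.assoc)
      qed
    qed
  qed
qed

lemma SUP_cond_prob_path_ball:
  assumes Y: "continuous_cond_prob T P (path_ball T m r) Y"
  shows "AE \<omega> in P. \<omega> \<in> path_ball_compl T m r \<longrightarrow>
    (\<forall>p>1. (SUP t\<in>{0..<T}. ereal (Y t \<omega> / (T - t) powr (p - 1))) < \<infinity>)"
proof -
  \<comment> \<open>The exit time \<open>s\<close> depends on the path as well; running over
    rational pairs \<open>s < t\<close> leaves a single null set.\<close>
  have "AE \<omega> in P. \<forall>s\<in>\<rat> \<inter> {0<..<T}. \<forall>t\<in>\<rat> \<inter> {s<..<T}. r < \<bar>\<omega> s - m\<bar> \<longrightarrow> Y t \<omega> \<le> 0"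
  proof (subst AE_ball_countable, simp add: countable_rat, intro ballI,
      subst AE_ball_countable, simp add: countable_rat, intro ballI)
    fix s t :: real assume st: "s \<in> \<rat> \<inter> {0<..<T}" "t \<in> \<rat> \<inter> {s<..<T}"
    have "AE \<omega> in completion P. r < \<bar>\<omega> s - m\<bar> \<longrightarrow> Y t \<omega> \<le> 0"
      using cond_prob_path_ball_le[of s t r m] AE_continuous_cond_prob(2)[OF Y, of t] st
      by auto
    then show "AE \<omega> in P. r < \<bar>\<omega> s - m\<bar> \<longrightarrow> Y t \<omega> \<le> 0"
      by (simp add: AE_completion_iff)
  qed
  then show ?thesis
    using AE_continuous_cond_prob(1)[OF Y] AE_space
  proof eventually_elim
    case (elim \<omega>)
    show ?case
    proof (intro impI allI)
      fix p :: real assume p: "1 < p" and B: "\<omega> \<in> path_ball_compl T m r"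
      have "\<exists>s\<in>\<rat> \<inter> {0<..<T}. \<not> \<bar>\<omega> s - m\<bar> \<le> r"
        using B mem_path_ball_rationals[OF elim(3), of m r] by blast
      then obtain s where s: "s \<in> \<rat>" "0 < s" "s < T" "r < \<bar>\<omega> s - m\<bar>"
        by (auto simp only: not_le Int_iff greaterThanLessThan_iff)
      have cont: "continuous_on {s..T} (\<lambda>u. Y u \<omega>)"
        using continuous_on_subset[OF elim(2), of "{s..T}"] s by auto
      have "Y u \<omega> \<le> 0" if "u \<in> \<rat>" "s < u" "u < T" for u
        using bspec[OF bspec[OF elim(1), of s], of u] s that by simp
      from continuous_on_le_of_rationals[OF s(3) cont this]
      have "Y t \<omega> \<le> 0" if "s \<le> t" "t < T" for t
        using that by simp
      \<comment> \<open>From time \<open>s\<close> on the numerator is at most 0, so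
        \<open>C = 0\<close> works for every exponent and \<open>p\<close> needs no upper
        bound.\<close>
      then show "(SUP t\<in>{0..<T}. ereal (Y t \<omega> / (T - t) powr (p - 1))) < \<infinity>"
        using s p by (intro SUP_divide_powr_finite[OF elim(2), where a=s and C=0]) auto
    qed
  qed
qed

end

theorem corollary1:
  fixes T m r x0 :: real
    and P :: "(real \<Rightarrow> real) measure"
    and X Y :: "real \<Rightarrow> (real \<Rightarrow> real) \<Rightarrow> real"
  assumes "T > 0" and "r > 0" and "\<bar>x0 - m\<bar> < r"
    and "wiener_measure T x0 P"
    and "continuous_cond_prob T P (path_ball_compl T m r) X"
    and "continuous_cond_prob T P (path_ball T m r) Y"
  shows "(AE \<omega> in P. \<omega> \<in> path_ball T m r \<longrightarrow>
            (\<forall>p\<in>{1<..<2}. (SUP t\<in>{0..<T}. ereal (X t \<omega> / (T - t) powr (p - 1))) < \<infinity>)) \<and>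
         (AE \<omega> in P. \<omega> \<in> path_ball_compl T m r \<longrightarrow>
            (\<forall>p>1. (SUP t\<in>{0..<T}. ereal (Y t \<omega> / (T - t) powr (p - 1))) < \<infinity>))"
proof -
  interpret wiener T x0 P
    using assms by unfold_locales
  show ?thesis
    using SUP_cond_prob_path_ball_compl SUP_cond_prob_path_ball assms(5,6) by blast
qed

end
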